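(* Let $d\in\mathbb{N}$ and let $0<m<s<d$ be real numbers. Then there exist constants $p=p(m,s,d)>0$ and $\delta_0=\delta_0(m,s,d)>0$ such that, for all $0<\delta<\delta_0$, there exists $\epsilon=\epsilon(m,s,d,\delta)>0$ with the following property. If $\mu$ is a measure on $\mathbb{R}^d$, then for $\mu$ almost every $x\in\Omega_s(\mu)$ and for all large enough $N\in\mathbb{N}$ (depending on $x$), we have $$\hom_{\delta,\epsilon,2^{-k}}(\mu,x)\ge\delta^{-m}\quad\text{for at least } pN \text{ values } k\in[N].\qquad( * )$$ Moreover, for $\mu$ almost all $x\in\Omega^s(\mu)$, the estimate $( * )$ holds for infinitely many $N\in\mathbb{N}$.
   Context: A measure on $\mathbb{R}^d$ means a Borel regular, locally finite outer measure with compact support. $B(x,r)$ is the closed ball with center $x$ and radius $r$. $[N]=\{1,\dots,N\}$. Local dimensions: $\overline{\dim}_{\mathrm{loc}}(\mu,x)=\limsup_{r\searrow0}\frac{\log\mu(B(x,r))}{\log r}$ and $\underline{\dim}_{\mathrm{loc}}(\mu,x)=\liminf_{r\searrow0}\frac{\log\mu(B(x,r))}{\log r}$. Set $\Omega^s(\mu)=\{x:\overline{\dim}_{\mathrm{loc}}(\mu,x)\ge s\}$ and $\Omega_s(\mu)=\{x:\underline{\dim}_{\mathrm{loc}}(\mu,x)\ge s\}$. A $\delta$-packing of a set $A\subset\mathbb{R}^d$ is a disjoint collection of balls of radius $\delta$ centred in $A$. The local homogeneity of $\mu$ at $x$ with parameters $\delta,\epsilon,r>0$ is $$\hom_{\delta,\epsilon,r}(\mu,x)=\sup\{\operatorname{card}\mathcal{B}:\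 \mathcal{B}\text{ is a }(\delta r)\text{-packing of }B(x,r)\text{ with }\mu(B)>\epsilon\,\mu(B(x,5r))\text{ for all }B\in\mathcal{B}\}.$$ *)

theory Defs
  imports "HOL-Analysis.Analysis"
begin

definition outer_support :: "('a::metric_space set \<Rightarrow> ennreal) \<Rightarrow> 'a set" where
  "outer_support \<mu> = {x. \<forall>r>0. \<mu> (cball x r) > 0}"

text \<open>
  A measure is an outer measure, i.e. it is defined on all subsets. The Caratheodory measurable
  sets are \<^const>\<open>lambda_system\<close>, and Borel regularity says that Borel sets are measurable and that
  each set has a Borel hull of the same measure.
\<close>

definition borel_regular :: "('a::topological_space set \<Rightarrow> ennreal) \<Rightarrow> bool" where
  "borel_regular \<mu> \<longleftrightarrow>
     sets borel \<subseteq> lambda_system UNIV UNIV \<mu> \<and>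
     (\<forall>A. \<exists>B\<in>sets borel. A \<subseteq> B \<and> \<mu> B = \<mu> A)"

definition compactly_supported_measure :: "('a::metric_space set \<Rightarrow> ennreal) \<Rightarrow> bool" where
  "compactly_supported_measure \<mu> \<longleftrightarrow>
     outer_measure_space UNIV \<mu> \<and>
     borel_regular \<mu> \<and>
     (\<forall>x. \<exists>U. open U \<and> x \<in> U \<and> \<mu> U < \<infinity>) \<and>
     compact (outer_support \<mu>)"

definition almost_all_in :: "('a set \<Rightarrow> ennreal) \<Rightarrow> 'a set \<Rightarrow> ('a \<Rightarrow> bool) \<Rightarrow> bool" where
  "almost_all_in \<mu> A P \<longleftrightarrow> \<mu> {x \<in> A. \<not> P x} = 0"

text \<open>
  The library has \<open>ln 0 = 0\<close> on the reals. Here \<open>log 0 = -\<infinity>\<close>, so that the local dimension of a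
  measure at a point outside its support is \<open>\<infinity>\<close>.
\<close>

definition elog :: "ennreal \<Rightarrow> ereal" where
  "elog a = (if a = 0 then -\<infinity> else if a = \<infinity> then \<infinity> else ereal (ln (enn2real a)))"

definition upper_local_dim :: "('a::metric_space set \<Rightarrow> ennreal) \<Rightarrow> 'a \<Rightarrow> ereal" where
  "upper_local_dim \<mu> x = Limsup (at_right 0) (\<lambda>r. elog (\<mu> (cball x r)) / ereal (ln r))"

definition lower_local_dim :: "('a::metric_space set \<Rightarrow> ennreal) \<Rightarrow> 'a \<Rightarrow> ereal" where
  "lower_local_dim \<mu> x = Liminf (at_right 0) (\<lambda>r. elog (\<mu> (cball x r)) / ereal (ln r))"

definition Omega_upper :: "real \<Rightarrow> ('a::metric_space set \<Rightarrow> ennreal) \<Rightarrow> 'a set" where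
  "Omega_upper s \<mu> = {x. upper_local_dim \<mu> x \<ge> ereal s}"

definition Omega_lower :: "real \<Rightarrow> ('a::metric_space set \<Rightarrow> ennreal) \<Rightarrow> 'a set" where
  "Omega_lower s \<mu> = {x. lower_local_dim \<mu> x \<ge> ereal s}"

definition is_packing :: "real \<Rightarrow> 'a::metric_space set \<Rightarrow> 'a set set \<Rightarrow> bool" where
  "is_packing \<delta> A \<B> \<longleftrightarrow> disjoint \<B> \<and> (\<forall>B\<in>\<B>. \<exists>x\<in>A. B = cball x \<delta>)"

text \<open>
  The cardinality of a packing is taken in \<^typ>\<open>ennreal\<close> with counting measure, because
  \<^const>\<open>card\<close> is 0 on infinite sets and the supremum of an unbounded set of naturals is
  unspecified.
\<close>

definition local_hom ::
  "real \<Rightarrow> real \<Rightarrow> real \<Rightarrow> ('a::metric_space set \<Rightarrow> ennreal) \<Rightarrow> 'a \<Rightarrow> ennreal" where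
  "local_hom \<delta> \<epsilon> r \<mu> x =
     (SUP \<B> \<in> {\<B>. is_packing (\<delta> * r) (cball x r) \<B> \<and>
                   (\<forall>B\<in>\<B>. \<mu> B > ennreal \<epsilon> * \<mu> (cball x (5 * r)))}.
        emeasure (count_space UNIV) \<B>)"

definition many_homogeneous_scales ::
  "real \<Rightarrow> real \<Rightarrow> real \<Rightarrow> real \<Rightarrow> ('a::metric_space set \<Rightarrow> ennreal) \<Rightarrow> 'a \<Rightarrow> nat \<Rightarrow> bool" where
  "many_homogeneous_scales m p \<delta> \<epsilon> \<mu> x N \<longleftrightarrow>
     real (card {k\<in>{1..N}. local_hom \<delta> \<epsilon> (2 powr - real k) \<mu> x \<ge> ennreal (\<delta> powr - m)})
       \<ge> p * real N"

end

theory Submission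
  imports Defs
begin

text \<open>
  Fix \<open>q\<close> with \<open>2\<^sup>q \<approx> 8 / \<delta>\<close> and look at the scales \<open>r\<^sub>j = r\<^sub>0 2\<^bsup>- q j\<^esup>\<close>, with space cut into grid
  cells of diameter at most \<open>r\<^sub>j\<close>. If a cell contains a point \<open>z\<close> with homogeneity below
  \<open>\<delta>\<^bsup>- m\<^esup>\<close>, then the points \<open>x\<close> of the cell with \<open>\<mu> (B(x, \<delta> r\<^sub>j)) > \<epsilon> \<mu> (B(z, 5 r\<^sub>j))\<close> lie in
  \<open>O(\<delta>\<^bsup>- m\<^esup>)\<close> cells of the next scale; at each of the other points, called exceptional,
  the measure of a fattened cell drops by the factor \<open>\<epsilon>\<close> when passing to the next scale.
  Consider points with few homogeneous scales among the first \<open>n\<close>. Those with many exceptional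
  scales lie in cells of total measure at most \<open>(K \<epsilon>\<^sup>p)\<^sup>n\<close> up to constants, which is tiny because
  \<open>\<epsilon>\<close> may depend on \<open>\<delta>\<close>. The remaining ones are covered by about \<open>2\<^bsup>q n (m + 2 p d)\<^esup>\<close> cells, so
  those with \<open>\<mu> (B(x, 2\<^bsup>- q n\<^esup>)) \<le> 2\<^bsup>- t q n\<^esup>\<close> have summable measure when \<open>m < t\<close>. Borel-Cantelli
  now bounds the local dimensions by \<open>t < s\<close> at almost every point where the claim fails.
\<close>

section \<open>Outer measures\<close>

lemma outer_mono:
  assumes "outer_measure_space UNIV \<mu>" "A \<subseteq> B"
  shows "\<mu> A \<le> \<mu> B"
  using assms by (auto simp: outer_measure_space_def increasing_def)

text \<open>The axiom \<open>countably_subadditive\<close> speaks of disjoint families only;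
  \<open>disjointed A\<close> has the same union and smaller members.\<close>

lemma outer_UN_le:
  fixes A :: "nat \<Rightarrow> 'a set"
  assumes \<mu>: "outer_measure_space UNIV \<mu>"
  shows "\<mu> (\<Union>i. A i) \<le> (\<Sum>i. \<mu> (A i))"
proof -
  have "\<mu> (\<Union>i. A i) = \<mu> (\<Union>i. disjointed A i)"
    by (simp add: UN_disjointed_eq)
  also have "\<dots> \<le> (\<Sum>i. \<mu> (disjointed A i))"
    using \<mu> disjoint_family_disjointed[of A]
    by (auto simp: outer_measure_space_def countably_subadditive_def)
  also have "\<dots> \<le> (\<Sum>i. \<mu> (A i))"
    by (intro suminf_le outer_mono[OF \<mu>] disjointed_subset) auto
  finally show ?thesis .
qed

lemma outer_finite_UN_le:
  assumes \<mu>: "outer_measure_space UNIV \<mu>" and "finite I"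
  shows "\<mu> (\<Union>i\<in>I. A i) \<le> (\<Sum>i\<in>I. \<mu> (A i))"
  using \<open>finite I\<close>
proof induction
  case empty
  then show ?case using \<mu> by (simp add: outer_measure_space_def positive_def)
next
  case (insert i I)
  have e: "\<mu> {} = 0" using \<mu> by (simp add: outer_measure_space_def positive_def)
  let ?B = "\<lambda>k::nat. if k = 0 then A i else if k = 1 then (\<Union>j\<in>I. A j) else {}"
  have "(\<Union>j\<in>insert i I. A j) = (\<Union>k. ?B k)" by (auto split: if_splits)
  then have "\<mu> (\<Union>j\<in>insert i I. A j) \<le> (\<Sum>k. \<mu> (?B k))"
    using outer_UN_le[OF \<mu>, of ?B] by simp
  also have "\<dots> = (\<Sum>k<2. \<mu> (?B k))"
    by (rule suminf_finite) (auto simp: e)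
  also have "\<dots> = \<mu> (A i) + \<mu> (\<Union>j\<in>I. A j)" by (simp add: numeral_2_eq_2)
  also have "\<dots> \<le> \<mu> (A i) + (\<Sum>j\<in>I. \<mu> (A j))" using insert by (simp add: add_left_mono)
  finally show ?case using insert by simp
qed

lemma outer_null_Union:
  assumes \<mu>: "outer_measure_space UNIV \<mu>" and "countable F" "\<And>A. A \<in> F \<Longrightarrow> \<mu> A = 0"
  shows "\<mu> (\<Union>F) = 0"
proof (cases "F = {}")
  case True
  then show ?thesis using \<mu> by (simp add: outer_measure_space_def positive_def)
next
  case False
  have "\<mu> (\<Union>F) = \<mu> (\<Union>i. from_nat_into F i)"
    using False assms(2) by (simp add: range_from_nat_into)
  also have "\<dots> \<le> (\<Sum>i. \<mu> (from_nat_into F i))" by (rule outer_UN_le[OF \<mu>])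
  also have "\<dots> = 0" using assms(3) False by (simp add: from_nat_into)
  finally show ?thesis by simp
qed

text \<open>For each large \<open>k\<close> the limsup set lies in the union of the
  \<open>E n\<close> with \<open>n \<ge> k\<close>, and the geometric tail tends to 0. Only
  countable subadditivity enters, so the sets \<open>E n\<close> are arbitrary.\<close>

lemma outer_borel_cantelli:
  assumes \<mu>: "outer_measure_space UNIV \<mu>"
    and E: "\<And>n. n \<ge> n0 \<Longrightarrow> \<mu> (E n) \<le> ennreal (C / 2 ^ n)" and "C \<ge> 0"
  shows "\<mu> {x. \<exists>\<^sub>F n in sequentially. x \<in> E n} = 0"
proof -
  have "\<mu> {x. \<exists>\<^sub>F n in sequentially. x \<in> E n} \<le> ennreal (2 * C / 2 ^ k)" if "k \<ge> n0" for k
  proof -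
    have "{x. \<exists>\<^sub>F n in sequentially. x \<in> E n} \<subseteq> (\<Union>i. E (i + k))"
    proof safe
      fix x assume "\<exists>\<^sub>F n in sequentially. x \<in> E n"
      then obtain n where "n \<ge> k" "x \<in> E n" by (auto simp: frequently_sequentially)
      then have "x \<in> E ((n - k) + k)" by simp
      then show "x \<in> (\<Union>i. E (i + k))" by blast
    qed
    then have "\<mu> {x. \<exists>\<^sub>F n in sequentially. x \<in> E n} \<le> \<mu> (\<Union>i. E (i + k))"
      by (rule outer_mono[OF \<mu>])
    also have "\<dots> \<le> (\<Sum>i. \<mu> (E (i + k)))" by (rule outer_UN_le[OF \<mu>])
    also have "\<dots> \<le> (\<Sum>i. ennreal (C / 2 ^ (i + k)))"
      using that by (intro suminf_le E) auto
    also have "\<dots> = (\<Sum>i. ennreal (C / 2 ^ k * (1/2) ^ i))"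
      by (simp add: power_add power_one_over field_simps)
    also have "\<dots> = ennreal (2 * C / 2 ^ k)"
    proof (rule suminf_ennreal_eq)
      show "0 \<le> C / 2 ^ k * (1 / 2) ^ i" for i using \<open>C \<ge> 0\<close> by simp
      show "(\<lambda>i. C / 2 ^ k * (1 / 2) ^ i) sums (2 * C / 2 ^ k)"
        using sums_mult[OF geometric_sums[of "1/2::real"], of "C / 2 ^ k"] by (simp add: mult_ac)
    qed
    finally show ?thesis .
  qed
  moreover have "(\<lambda>k. ennreal (2 * C / 2 ^ k)) \<longlonglongrightarrow> ennreal 0"
  proof (rule tendsto_ennrealI)
    show "(\<lambda>k. 2 * C / 2 ^ k) \<longlonglongrightarrow> 0"
      using LIMSEQ_divide_realpow_zero[of 2 "2 * C"] by simp
  qed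
  ultimately have "\<mu> {x. \<exists>\<^sub>F n in sequentially. x \<in> E n} \<le> ennreal 0"
    by (intro LIMSEQ_le_const) auto
  then show ?thesis by simp
qed

text \<open>The complement of the support is covered by open balls of measure zero, and by Lindelof
  countably many of them suffice.\<close>

lemma outer_support_null:
  fixes \<mu> :: "'a::euclidean_space set \<Rightarrow> ennreal"
  assumes \<mu>: "outer_measure_space UNIV \<mu>"
  shows "\<mu> (- outer_support \<mu>) = 0"
proof -
  define F where "F = {ball x r | x r. \<mu> (cball x r) = 0}"
  obtain F' where F': "F' \<subseteq> F" "countable F'" "\<Union>F' = \<Union>F"
    by (rule Lindelof[of F]) (auto simp: F_def)
  have "\<mu> (\<Union>F') = 0"
  proof (rule outer_null_Union[OF \<mu> F'(2)])
    fix A assume "A \<in> F'"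
    then obtain x r where "A = ball x r" "\<mu> (cball x r) = 0" using F' by (auto simp: F_def)
    then show "\<mu> A = 0" using outer_mono[OF \<mu>, of A "cball x r"] by auto
  qed
  moreover have "- outer_support \<mu> \<subseteq> \<Union>F'"
  proof
    fix x assume "x \<in> - outer_support \<mu>"
    then obtain r where "r > 0" "\<mu> (cball x r) = 0"
      by (auto simp: outer_support_def zero_less_iff_neq_zero)
    then have "x \<in> ball x r" "ball x r \<in> F" by (auto simp: F_def)
    then show "x \<in> \<Union>F'" unfolding F'(3) by (rule UnionI[rotated])
  qed
  ultimately show ?thesis using outer_mono[OF \<mu>, of "- outer_support \<mu>" "\<Union>F'"] by auto
qed

text \<open>Finitely many open sets of finite measure cover the compact support, and the rest is
  null.\<close>

lemma compactly_supported_measure_finite: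
  fixes \<mu> :: "'a::euclidean_space set \<Rightarrow> ennreal"
  assumes "compactly_supported_measure \<mu>"
  shows "\<mu> UNIV < \<infinity>"
proof -
  have \<mu>: "outer_measure_space UNIV \<mu>"
    and lf: "\<And>x. \<exists>U. open U \<and> x \<in> U \<and> \<mu> U < \<infinity>" and c: "compact (outer_support \<mu>)"
    using assms by (auto simp: compactly_supported_measure_def)
  obtain D where D: "D \<subseteq> {U. open U \<and> \<mu> U < \<infinity>}" "finite D" "outer_support \<mu> \<subseteq> \<Union>D"
    by (rule compactE[OF c, of "{U. open U \<and> \<mu> U < \<infinity>}"]) (use lf in blast)+
  have "UNIV = (\<Union>A\<in>insert (- outer_support \<mu>) D. A)" using D by auto
  then have "\<mu> UNIV \<le> (\<Sum>A\<in>insert (- outer_support \<mu>) D. \<mu> A)"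
    using outer_finite_UN_le[OF \<mu>, of "insert (- outer_support \<mu>) D" "\<lambda>A. A"] D by simp
  also have "\<dots> < \<infinity>" using D outer_support_null[OF \<mu>]
    by (auto simp: ennreal_sum_less_top)
  finally show ?thesis .
qed

text \<open>Counting in a tree: \<open>\<pi> j x\<close> is the vertex of \<open>x\<close> at level
  \<open>j\<close>, and \<open>b j\<close> bounds the branching seen by the points with
  \<open>P j\<close>. Each new vertex comes from a point whose previous vertex was already counted,
  so the levels need not be nested.\<close>

lemma card_image_chain_le:
  fixes \<pi> :: "nat \<Rightarrow> 'a \<Rightarrow> 'b"
  assumes fin: "finite (\<pi> 0 ` S)"
    and step: "\<And>j Q. finite (\<pi> (Suc j) ` {x. \<pi> j x = Q \<and> P j x}) \<and>
        real (card (\<pi> (Suc j) ` {x. \<pi> j x = Q \<and> P j x})) \<le> b j"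
  shows "finite (\<pi> n ` {x \<in> S. \<forall>j<n. P j x}) \<and>
    real (card (\<pi> n ` {x \<in> S. \<forall>j<n. P j x})) \<le> real (card (\<pi> 0 ` S)) * (\<Prod>j<n. b j)"
proof (induction n)
  case 0
  then show ?case using fin by simp
next
  case (Suc n)
  let ?T = "\<pi> n ` {x \<in> S. \<forall>j<n. P j x}"
  let ?C = "\<lambda>Q. \<pi> (Suc n) ` {x. \<pi> n x = Q \<and> P n x}"
  have sub: "\<pi> (Suc n) ` {x \<in> S. \<forall>j<Suc n. P j x} \<subseteq> (\<Union>Q\<in>?T. ?C Q)"
    by (fastforce simp: less_Suc_eq)
  have fT: "finite ?T" using Suc by simp
  have fU: "finite (\<Union>Q\<in>?T. ?C Q)" using fT step by blast
  have "real (card (\<pi> (Suc n) ` {x \<in> S. \<forall>j<Suc n. P j x})) \<le> real (card (\<Union>Q\<in>?T. ?C Q))"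
    using card_mono[OF fU sub] by simp
  also have "\<dots> \<le> real (\<Sum>Q\<in>?T. card (?C Q))"
    using card_UN_le[OF fT] of_nat_le_iff by blast
  also have "\<dots> \<le> (\<Sum>Q\<in>?T. b n)" unfolding of_nat_sum by (intro sum_mono) (use step in blast)
  also have "\<dots> = real (card ?T) * b n" by simp
  \<comment> \<open>The instance of \<open>step\<close> at an arbitrary vertex gives
    \<open>b n \<ge> 0\<close>, which monotonicity of the product requires.\<close>
  also have "\<dots> \<le> (real (card (\<pi> 0 ` S)) * (\<Prod>j<n. b j)) * b n"
    by (intro mult_right_mono) (use Suc step[of n undefined] of_nat_0_le_iff order_trans in blast)+
  finally show ?case using finite_subset[OF sub fU] by (simp add: mult.assoc)
qed

section \<open>Grid cells\<close>

text \<open>The lower corner of the half-open grid cube of side \<open>\<rho>\<close> around the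
  point. It serves as the name of the cube.\<close>

definition grid_round :: "real \<Rightarrow> real ^ 'n \<Rightarrow> real ^ 'n" where
  "grid_round \<rho> x = (\<chi> i. \<rho> * of_int \<lfloor>x $ i / \<rho>\<rfloor>)"

text \<open>Each coordinate moves by at most \<open>\<rho>\<close>, and the norm is at most the sum
  of the coordinates. The resulting factor is the dimension, on which all constants may
  depend.\<close>

lemma dist_grid_round:
  fixes x :: "real ^ 'n"
  assumes "\<rho> > 0"
  shows "dist x (grid_round \<rho> x) \<le> real CARD('n) * \<rho>"
proof -
  have "\<bar>(x - grid_round \<rho> x) $ i\<bar> \<le> \<rho>" for i
  proof -
    have "x $ i - \<rho> * of_int \<lfloor>x $ i / \<rho>\<rfloor> = \<rho> * frac (x $ i / \<rho>)"
      using assms by (simp add: frac_def field_simps)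
    moreover have "0 \<le> \<rho> * frac (x $ i / \<rho>)" "\<rho> * frac (x $ i / \<rho>) \<le> \<rho> * 1"
      using assms frac_lt_1[of "x $ i / \<rho>"] by (auto intro!: mult_left_mono simp del: mult_1_right)
    ultimately show ?thesis by (simp add: grid_round_def)
  qed
  then have "(\<Sum>i\<in>UNIV. \<bar>(x - grid_round \<rho> x) $ i\<bar>) \<le> (\<Sum>i\<in>(UNIV::'n set). \<rho>)"
    by (rule sum_mono)
  then show ?thesis using norm_le_l1_cart[of "x - grid_round \<rho> x"] by (simp add: dist_norm)
qed

text \<open>In each coordinate the index of the cube is the floor of a number from an interval of
  length \<open>2 * R\<close>, which leaves at most \<open>2 * R + 2\<close> values.\<close>

lemma card_grid_round_cball:
  fixes z :: "real ^ 'n"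
  assumes "\<rho> > 0" "R \<ge> 0"
  shows "finite (grid_round \<rho> ` cball z (R * \<rho>))"
    and "real (card (grid_round \<rho> ` cball z (R * \<rho>))) \<le> (2 * R + 2) ^ CARD('n)"
proof -
  let ?I = "\<lambda>i. {\<lfloor>z $ i / \<rho> - R\<rfloor>..\<lfloor>z $ i / \<rho> + R\<rfloor>}"
  let ?V = "PiE UNIV ?I"
  let ?g = "\<lambda>v. (\<chi> i. \<rho> * real_of_int (v i)) :: real ^ 'n"
  have fV: "finite ?V" by (intro finite_PiE) auto
  have sub: "grid_round \<rho> ` cball z (R * \<rho>) \<subseteq> ?g ` ?V"
  proof safe
    fix x assume x: "x \<in> cball z (R * \<rho>)"
    have "\<lfloor>x $ i / \<rho>\<rfloor> \<in> ?I i" for i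
    proof -
      have "\<bar>(z - x) $ i\<bar> \<le> R * \<rho>"
        using x component_le_norm_cart[of "z - x" i] by (simp add: dist_norm)
      then have "\<bar>z $ i / \<rho> - x $ i / \<rho>\<bar> \<le> R"
        using assms by (simp add: diff_divide_distrib[symmetric] pos_divide_le_eq)
      then show ?thesis by (auto intro!: floor_mono)
    qed
    then show "grid_round \<rho> x \<in> ?g ` ?V"
      by (intro image_eqI[of _ _ "\<lambda>i. \<lfloor>x $ i / \<rho>\<rfloor>"]) (auto simp: grid_round_def)
  qed
  show "finite (grid_round \<rho> ` cball z (R * \<rho>))" using finite_subset[OF sub] fV by blast
  have "card (grid_round \<rho> ` cball z (R * \<rho>)) \<le> card ?V"
    using surj_card_le[OF fV sub] .
  then have "real (card (grid_round \<rho> ` cball z (R * \<rho>))) \<le> real (card ?V)" by simp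
  also have "\<dots> = (\<Prod>i\<in>UNIV. real (card (?I i)))"
    by (subst card_PiE) (simp_all only: finite of_nat_prod)
  also have "\<dots> \<le> (\<Prod>i\<in>(UNIV::'n set). 2 * R + 2)"
  proof (intro prod_mono conjI)
    fix i
    have "\<lfloor>z $ i / \<rho> - R\<rfloor> \<le> \<lfloor>z $ i / \<rho> + R\<rfloor>" using assms by (intro floor_mono) auto
    then have "real (card (?I i)) = of_int (\<lfloor>z $ i / \<rho> + R\<rfloor> - \<lfloor>z $ i / \<rho> - R\<rfloor> + 1)" by simp
    also have "\<dots> \<le> 2 * R + 2" by linarith
    finally show "real (card (?I i)) \<le> 2 * R + 2" .
  qed auto
  finally show "real (card (grid_round \<rho> ` cball z (R * \<rho>))) \<le> (2 * R + 2) ^ CARD('n)" by simp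
qed

lemma local_hom_less_cover:
  assumes hom: "local_hom \<delta> \<epsilon> r \<mu> z < ennreal c" and "\<delta> > 0" "r > 0"
    and S: "S \<subseteq> cball z r" "\<And>y. y \<in> S \<Longrightarrow> \<mu> (cball y (\<delta> * r)) > ennreal \<epsilon> * \<mu> (cball z (5 * r))"
  obtains Y where "finite Y" "real (card Y) \<le> c" "S \<subseteq> (\<Union>y\<in>Y. cball y (2 * (\<delta> * r)))"
proof -
  define Sep where "Sep Y \<longleftrightarrow> finite Y \<and> Y \<subseteq> S \<and> (\<forall>x\<in>Y. \<forall>y\<in>Y. x \<noteq> y \<longrightarrow> 2 * (\<delta> * r) < dist x y)" for Y
  have c: "c > 0" using hom by (cases "c > 0") (auto simp: ennreal_neg)
  have bound: "real (card Y) \<le> c" if "Sep Y" for Y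
  proof -
    let ?b = "\<lambda>y. cball y (\<delta> * r)"
    have rp: "\<delta> * r > 0" using assms by simp
    have disj: "cball x (\<delta> * r) \<inter> cball y (\<delta> * r) = {}" if "x \<in> Y" "y \<in> Y" "x \<noteq> y" for x y
    proof -
      have "2 * (\<delta> * r) < dist x y" using that \<open>Sep Y\<close> by (auto simp: Sep_def)
      then have "dist x z \<le> \<delta> * r \<Longrightarrow> dist y z \<le> \<delta> * r \<Longrightarrow> False" for z
        using dist_triangle2[of x y z] by linarith
      then show ?thesis by auto
    qed
    \<comment> \<open>A packing is a set of balls, so distinct centres must give distinct balls for
      the cardinalities to agree.\<close>
    have inj: "inj_on ?b Y"
    proof (rule inj_onI, rule ccontr)
      fix x y assume *: "x \<in> Y" "y \<in> Y" "?b x = ?b y" "x \<noteq> y"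
      then have "x \<in> ?b x \<inter> ?b y" using rp by auto
      then show False using disj * by blast
    qed
    have "is_packing (\<delta> * r) (cball z r) (?b ` Y)"
      using disj \<open>Sep Y\<close> S(1) unfolding is_packing_def disjoint_def Sep_def by fast
    moreover have "\<forall>B\<in>?b ` Y. \<mu> B > ennreal \<epsilon> * \<mu> (cball z (5 * r))"
      using S(2) \<open>Sep Y\<close> by (auto simp: Sep_def)
    ultimately have "emeasure (count_space UNIV) (?b ` Y) \<le> local_hom \<delta> \<epsilon> r \<mu> z"
      unfolding local_hom_def by (intro SUP_upper) auto
    moreover have "emeasure (count_space UNIV) (?b ` Y) = of_nat (card Y)"
      using \<open>Sep Y\<close> card_image[OF inj] by (simp add: Sep_def emeasure_count_space)
    ultimately have "ennreal (real (card Y)) < ennreal c"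
      using hom by (simp add: ennreal_of_nat_eq_real_of_nat)
    then show ?thesis by (simp add: ennreal_less_iff)
  qed
  have "\<exists>Y. Sep Y \<and> (\<forall>Y'. Sep Y' \<longrightarrow> card Y' \<le> card Y)"
  proof (rule ex_has_greatest_nat)
    show "Sep {}" by (simp add: Sep_def)
    show "\<forall>Y. Sep Y \<longrightarrow> card Y < Suc (nat \<lfloor>c\<rfloor>)"
      using bound by (auto simp: less_Suc_eq_le le_nat_floor)
  qed
  then obtain Y where Y: "Sep Y" "\<And>Y'. Sep Y' \<Longrightarrow> card Y' \<le> card Y" by blast
  have "S \<subseteq> (\<Union>y\<in>Y. cball y (2 * (\<delta> * r)))"
  proof (rule ccontr)
    assume "\<not> ?thesis"
    then obtain x where "x \<in> S" "x \<notin> (\<Union>y\<in>Y. cball y (2 * (\<delta> * r)))" by blast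
    then have x: "x \<in> S" "\<And>y. y \<in> Y \<Longrightarrow> 2 * (\<delta> * r) < dist y x" by (auto simp: not_le)
    have "x \<notin> Y"
    proof
      assume "x \<in> Y"
      from x(2)[OF this] have "2 * (\<delta> * r) < 0" by simp
      moreover have "\<delta> * r > 0" using assms by simp
      ultimately show False by linarith
    qed
    moreover have "Sep (insert x Y)" using x Y(1) by (auto simp: Sep_def dist_commute)
    ultimately show False using Y(2)[of "insert x Y"] Y(1) by (simp add: Sep_def)
  qed
  then show thesis using that Y(1) bound by (auto simp: Sep_def)
qed

section \<open>The tree of cells\<close>

text \<open>The count of \<open>card_grid_round_cball\<close> for a ball of radius
  \<open>r j / 2\<close>, measured in grid cubes of the next scale, whose side is
  \<open>r (Suc j) / (2 * d)\<close>.\<close>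

definition child_bound :: "nat \<Rightarrow> nat \<Rightarrow> real" where
  "child_bound d q = (2 * (2 ^ q * real d) + 2) ^ d"

text \<open>Here \<open>\<delta> powr - m\<close> balls have to be covered, each of radius at most
  \<open>32 * r (Suc j)\<close>, that is \<open>64 * d\<close> sides of the next grid.\<close>

definition good_child_bound :: "nat \<Rightarrow> real \<Rightarrow> real \<Rightarrow> real" where
  "good_child_bound d m \<delta> = (2 * (64 * real d) + 2) ^ d * \<delta> powr - m"

lemma child_bound_ge_1: "child_bound d q \<ge> 1"
  unfolding child_bound_def by (intro one_le_power) simp

lemma good_child_bound_ge_1:
  assumes "0 < \<delta>" "\<delta> \<le> 1" "m \<ge> 0"
  shows "good_child_bound d m \<delta> \<ge> 1"
proof -
  have "1 * 1 \<le> good_child_bound d m \<delta>" unfolding good_child_bound_def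
  proof (intro mult_mono one_le_power)
    show "1 \<le> \<delta> powr - m" using assms powr_mono'[of "-m" 0 \<delta>] by simp
  qed auto
  then show ?thesis by simp
qed

text \<open>One sequence of scales with first scale \<open>r0\<close>. The bounds on
  \<open>q\<close> make the next scale comparable with \<open>\<delta> * r j\<close>: smaller by a
  factor between 8 and 16.\<close>

locale scale_tree =
  fixes \<mu> :: "(real ^ 'n) set \<Rightarrow> ennreal" and \<delta> \<epsilon> m r0 :: real and q :: nat and K L :: real
  assumes outer: "outer_measure_space UNIV \<mu>" and finite_UNIV: "\<mu> UNIV < \<infinity>"
    and r0: "r0 > 0" and \<delta>: "0 < \<delta>" "\<delta> \<le> 1" and \<epsilon>: "0 < \<epsilon>" "\<epsilon> \<le> 1" and m: "m \<ge> 0"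
    and q: "8 \<le> \<delta> * 2 ^ q" "\<delta> * 2 ^ q \<le> 16"
    and K_eq: "K = child_bound CARD('n) q" and L_eq: "L = good_child_bound CARD('n) m \<delta>"
begin

definition r :: "nat \<Rightarrow> real" where "r j = r0 / 2 ^ (q * j)"

text \<open>The side is chosen so that a point is within \<open>r j / 2\<close> of its corner and a
  cell has diameter at most \<open>r j\<close>.\<close>

definition cell :: "nat \<Rightarrow> real ^ 'n \<Rightarrow> real ^ 'n" where
  "cell j = grid_round (r j / (2 * real CARD('n)))"

definition hom :: "nat \<Rightarrow> real ^ 'n \<Rightarrow> bool" where
  "hom j x \<longleftrightarrow> ennreal (\<delta> powr - m) \<le> local_hom \<delta> \<epsilon> (r j) \<mu> x"

text \<open>One reference point per cell, so that all points of the cell are compared with the same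
  ball and a single packing bound counts the children. It is arbitrary if the whole cell is
  homogeneous.\<close>

definition rep :: "nat \<Rightarrow> real ^ 'n \<Rightarrow> real ^ 'n" where
  "rep j Q = (SOME z. cell j z = Q \<and> \<not> hom j z)"

definition exc :: "nat \<Rightarrow> real ^ 'n \<Rightarrow> bool" where
  "exc j x \<longleftrightarrow> \<not> hom j x \<and>
     \<mu> (cball x (\<delta> * r j)) \<le> ennreal \<epsilon> * \<mu> (cball (rep j (cell j x)) (5 * r j))"

lemma r_pos: "r j > 0"
  using r0 by (simp add: r_def)

lemma r_Suc: "r (Suc j) = r j / 2 ^ q"
  by (simp add: r_def power_add)

lemma two_power_q: "8 \<le> (2::real) ^ q"
proof -
  have "\<delta> * 2 ^ q \<le> 1 * 2 ^ q" by (intro mult_right_mono \<delta>) simp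
  then show ?thesis using q by linarith
qed

text \<open>The factor 8 leaves room for a radius \<open>6 * r (Suc j)\<close> together with the
  distance \<open>r (Suc j) / 2\<close> from a point to its corner.\<close>

lemma r_Suc_le: "8 * r (Suc j) \<le> r j" "8 * r (Suc j) \<le> \<delta> * r j"
proof -
  have *: "r j = 2 ^ q * r (Suc j)" by (simp add: r_Suc)
  show "8 * r (Suc j) \<le> r j" unfolding *
    using two_power_q r_pos[of "Suc j"] by (intro mult_right_mono) auto
  have "8 * r (Suc j) \<le> (\<delta> * 2 ^ q) * r (Suc j)"
    using q r_pos[of "Suc j"] by (intro mult_right_mono) auto
  then show "8 * r (Suc j) \<le> \<delta> * r j" unfolding * by (simp add: mult.assoc)
qed

lemma dist_cell: "dist x (cell j x) \<le> r j / 2"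
proof -
  have "r j / (2 * real CARD('n)) > 0" using r_pos by simp
  from dist_grid_round[OF this, of x] show ?thesis by (simp add: cell_def)
qed

lemma dist_same_cell: "cell j x = cell j y \<Longrightarrow> dist x y \<le> r j"
  using dist_cell[of x j] dist_cell[of y j] dist_triangle2[of x y "cell j x"] by simp

lemma K_ge_1: "K \<ge> 1"
  unfolding K_eq by (rule child_bound_ge_1)

lemma L_ge_1: "L \<ge> 1"
  unfolding L_eq using \<delta> m by (rule good_child_bound_ge_1)

lemma card_children:
  "finite (cell (Suc j) ` {x. cell j x = Q})" (is "finite ?A")
  "real (card (cell (Suc j) ` {x. cell j x = Q})) \<le> K"
proof -
  let ?\<rho> = "r (Suc j) / (2 * real CARD('n))"
  have \<rho>: "?\<rho> > 0" using r_pos by simp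
  have R: "2 ^ q * real CARD('n) * ?\<rho> = r j / 2" by (simp add: r_Suc)
  have "{x. cell j x = Q} \<subseteq> cball Q (r j / 2)" using dist_cell by (auto simp: dist_commute)
  then have sub: "?A \<subseteq> grid_round ?\<rho> ` cball Q (2 ^ q * real CARD('n) * ?\<rho>)"
    unfolding R cell_def by blast
  note c = card_grid_round_cball[OF \<rho>, of "2 ^ q * real CARD('n)" Q]
  show "finite ?A" using finite_subset[OF sub c(1)] by simp
  have "real (card ?A) \<le> real (card (grid_round ?\<rho> ` cball Q (2 ^ q * real CARD('n) * ?\<rho>)))"
    using card_mono[OF c(1) sub] by simp
  also have "\<dots> \<le> K" unfolding K_eq child_bound_def using c(2) by simp
  finally show "real (card ?A) \<le> K" .
qed

lemma rep:
  assumes "\<not> hom j x"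
  shows "cell j (rep j (cell j x)) = cell j x" "\<not> hom j (rep j (cell j x))"
proof -
  have "\<exists>z. cell j z = cell j x \<and> \<not> hom j z" using assms by blast
  from someI_ex[OF this] show "cell j (rep j (cell j x)) = cell j x" "\<not> hom j (rep j (cell j x))"
    by (auto simp: rep_def)
qed

text \<open>The reference point is not homogeneous, and the points counted here have heavy balls
  relative to it. So \<open>local_hom_less_cover\<close> puts them into at most
  \<open>\<delta> powr - m\<close> balls, each meeting boundedly many cells of the next
  scale.\<close>

lemma card_children_good:
  "real (card (cell (Suc j) ` {x. cell j x = Q \<and> \<not> hom j x \<and> \<not> exc j x})) \<le> L"
proof (cases "{x. cell j x = Q \<and> \<not> hom j x \<and> \<not> exc j x} = {}")
  case True
  then show ?thesis using L_ge_1 by (simp only:) simp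
next
  case False
  let ?S = "{x. cell j x = Q \<and> \<not> hom j x \<and> \<not> exc j x}"
  let ?z = "rep j Q"
  \<comment> \<open>Such a point makes \<open>rep j Q\<close> a genuine choice; hence the separate
    treatment of the empty set.\<close>
  obtain x0 where x0: "cell j x0 = Q" "\<not> hom j x0" using False by blast
  have z: "cell j ?z = Q" "\<not> hom j ?z" using rep[OF x0(2)] x0(1) by auto
  have hom: "local_hom \<delta> \<epsilon> (r j) \<mu> ?z < ennreal (\<delta> powr - m)"
    using z(2) by (simp add: hom_def not_le)
  have S: "?S \<subseteq> cball ?z (r j)" using z(1) dist_same_cell[of j ?z] by auto
  have S2: "ennreal \<epsilon> * \<mu> (cball ?z (5 * r j)) < \<mu> (cball y (\<delta> * r j))" if "y \<in> ?S" for y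
    using that by (auto simp: exc_def not_le)
  obtain Y where Y: "finite Y" "real (card Y) \<le> \<delta> powr - m"
    "?S \<subseteq> (\<Union>y\<in>Y. cball y (2 * (\<delta> * r j)))"
    by (rule local_hom_less_cover[OF hom \<delta>(1) r_pos S S2])
  let ?\<rho> = "r (Suc j) / (2 * real CARD('n))"
  let ?C = "\<lambda>y. grid_round ?\<rho> ` cball y (64 * real CARD('n) * ?\<rho>)"
  have \<rho>: "?\<rho> > 0" using r_pos by simp
  note c = card_grid_round_cball[OF \<rho>, of "64 * real CARD('n)"]
  have "2 * (\<delta> * r j) \<le> 32 * r (Suc j)"
  proof -
    have "2 * (\<delta> * r j) = 2 * (\<delta> * 2 ^ q) * r (Suc j)" by (simp add: r_Suc)
    also have "\<dots> \<le> 2 * 16 * r (Suc j)"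
      using q r_pos[of "Suc j"] by (intro mult_right_mono mult_left_mono) auto
    finally show ?thesis by simp
  qed
  then have R: "2 * (\<delta> * r j) \<le> 64 * real CARD('n) * ?\<rho>" by simp
  have sub: "cell (Suc j) ` ?S \<subseteq> (\<Union>y\<in>Y. ?C y)"
  proof
    fix w assume "w \<in> cell (Suc j) ` ?S"
    then obtain x where x: "x \<in> ?S" "w = cell (Suc j) x" by blast
    then obtain y where y: "y \<in> Y" "x \<in> cball y (2 * (\<delta> * r j))" using Y(3) by blast
    then have "x \<in> cball y (64 * real CARD('n) * ?\<rho>)" using R by auto
    then have "w \<in> ?C y" unfolding x(2) cell_def by (rule imageI)
    then show "w \<in> (\<Union>y\<in>Y. ?C y)" using y(1) by blast
  qed
  have "real (card (cell (Suc j) ` ?S)) \<le> real (card (\<Union>y\<in>Y. ?C y))"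
  proof -
    have "finite (\<Union>y\<in>Y. ?C y)" by (intro finite_UN_I Y(1) c(1)) simp
    from card_mono[OF this sub] show ?thesis by (rule of_nat_mono)
  qed
  also have "\<dots> \<le> real (\<Sum>y\<in>Y. card (?C y))"
    using card_UN_le[OF Y(1)] of_nat_le_iff by blast
  also have "\<dots> \<le> (\<Sum>y\<in>Y. (2 * (64 * real CARD('n)) + 2) ^ CARD('n))"
    unfolding of_nat_sum by (intro sum_mono c(2)) simp
  also have "\<dots> \<le> L" using Y(2) by (simp add: L_eq good_child_bound_def mult.commute mult_left_mono)
  finally show ?thesis .
qed

text \<open>The radius \<open>6 r\<^sub>j\<close> is large enough that the ball contains \<open>B(z, 5 r\<^sub>j)\<close> for every \<open>z\<close> in the cell
  of \<open>x\<close>, and small enough that at the next scale it is contained in \<open>B(x, \<delta> r\<^sub>j)\<close>.\<close>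

definition big :: "nat \<Rightarrow> real ^ 'n \<Rightarrow> ennreal" where
  "big j x = \<mu> (cball (cell j x) (6 * r j))"

lemma big_Suc_le: "big (Suc j) x \<le> big j x"
  unfolding big_def
proof (intro outer_mono[OF outer] subsetI)
  fix y assume "y \<in> cball (cell (Suc j) x) (6 * r (Suc j))"
  then have "dist (cell (Suc j) x) y \<le> 6 * r (Suc j)" by simp
  moreover have "dist (cell j x) y \<le> dist (cell j x) x + dist x (cell (Suc j) x) + dist (cell (Suc j) x) y"
    using dist_triangle[of "cell j x" y x] dist_triangle[of x y "cell (Suc j) x"] by linarith
  ultimately have "dist (cell j x) y \<le> 6 * r j"
    using dist_cell[of x j] dist_cell[of x "Suc j"] r_Suc_le(1)[of j] r_pos[of j] r_pos[of "Suc j"]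
    by (simp add: dist_commute)
  then show "y \<in> cball (cell j x) (6 * r j)" by simp
qed

lemma big_Suc_le_exc:
  assumes "exc j x"
  shows "big (Suc j) x \<le> ennreal \<epsilon> * big j x"
proof -
  have x: "\<not> hom j x" "\<mu> (cball x (\<delta> * r j)) \<le> ennreal \<epsilon> * \<mu> (cball (rep j (cell j x)) (5 * r j))"
    using assms by (auto simp: exc_def)
  have "big (Suc j) x \<le> \<mu> (cball x (\<delta> * r j))"
    unfolding big_def
  proof (intro outer_mono[OF outer] subsetI)
    fix y assume "y \<in> cball (cell (Suc j) x) (6 * r (Suc j))"
    then have "dist x y \<le> \<delta> * r j"
      using dist_triangle[of x y "cell (Suc j) x"] dist_cell[of x "Suc j"] r_Suc_le(2)[of j]
        r_pos[of "Suc j"] by simp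
    then show "y \<in> cball x (\<delta> * r j)" by simp
  qed
  also note x(2)
  also have "ennreal \<epsilon> * \<mu> (cball (rep j (cell j x)) (5 * r j)) \<le> ennreal \<epsilon> * big j x"
    unfolding big_def
  proof (intro mult_left_mono outer_mono[OF outer] subsetI)
    fix y assume "y \<in> cball (rep j (cell j x)) (5 * r j)"
    then show "y \<in> cball (cell j x) (6 * r j)"
      using dist_triangle[of "cell j x" y "rep j (cell j x)"] dist_cell[of "rep j (cell j x)" j]
        rep(1)[OF x(1)] r_pos[of j] by (simp add: dist_commute)
  qed simp
  finally show ?thesis .
qed

text \<open>Each exceptional scale contributes a factor \<open>\<epsilon>\<close>; at the other
  scales monotonicity is enough.\<close>

lemma big_le: "big n x \<le> ennreal (\<epsilon> ^ card {j. j < n \<and> exc j x}) * \<mu> UNIV"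
proof (induction n)
  case 0
  then show ?case by (auto simp: big_def intro: outer_mono[OF outer])
next
  case (Suc n)
  show ?case
  proof (cases "exc n x")
    case True
    then have "{j. j < Suc n \<and> exc j x} = insert n {j. j < n \<and> exc j x}" by auto
    then have e: "\<epsilon> ^ card {j. j < Suc n \<and> exc j x} = \<epsilon> * \<epsilon> ^ card {j. j < n \<and> exc j x}" by simp
    have "big (Suc n) x \<le> ennreal \<epsilon> * big n x" by (rule big_Suc_le_exc[OF True])
    also have "\<dots> \<le> ennreal \<epsilon> * (ennreal (\<epsilon> ^ card {j. j < n \<and> exc j x}) * \<mu> UNIV)"
      by (intro mult_left_mono Suc.IH) simp
    finally show ?thesis using \<epsilon> by (simp add: e ennreal_mult mult.assoc)
  next
    case False
    then have "{j. j < Suc n \<and> exc j x} = {j. j < n \<and> exc j x}" by (auto simp: less_Suc_eq)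
    then show ?thesis using order_trans[OF big_Suc_le Suc.IH] by simp
  qed
qed

section \<open>Measure of the points with few homogeneous scales in one tree\<close>

text \<open>This serves twice: for many cells of tiny measure, and for few cells whose measure is
  bounded through a ball.\<close>

lemma measure_le_cells:
  assumes "finite (cell n ` T)" "real (card (cell n ` T)) \<le> W" "v \<ge> 0"
    and v: "\<And>x. x \<in> T \<Longrightarrow> \<mu> {y \<in> T. cell n y = cell n x} \<le> ennreal v"
  shows "\<mu> T \<le> ennreal (W * v)"
proof -
  have "T = (\<Union>Q\<in>cell n ` T. {y \<in> T. cell n y = Q})" by auto
  then have "\<mu> T \<le> (\<Sum>Q\<in>cell n ` T. \<mu> {y \<in> T. cell n y = Q})"
    using outer_finite_UN_le[OF outer assms(1), of "\<lambda>Q. {y \<in> T. cell n y = Q}"] by simp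
  also have "\<dots> \<le> (\<Sum>Q\<in>cell n ` T. ennreal v)" by (intro sum_mono) (use v in auto)
  also have "\<dots> = ennreal (real (card (cell n ` T)) * v)"
    using \<open>v \<ge> 0\<close> by (simp add: ennreal_of_nat_eq_real_of_nat ennreal_mult)
  also have "\<dots> \<le> ennreal (W * v)" using assms by (intro ennreal_leI mult_right_mono)
  finally show ?thesis .
qed

text \<open>All points of \<open>E\<close> have the same homogeneous scales \<open>A\<close> and the
  same exceptional scales \<open>B\<close>. If \<open>B\<close> is large, every cell is tiny by
  \<open>big_le\<close>; if \<open>B\<close> is small, there are few cells. The bound is the sum of
  the two estimates.\<close>

lemma measure_type_le:
  assumes fin: "finite (cell 0 ` S)" and "E \<subseteq> S" "p \<ge> 0" "\<beta> \<ge> 0"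
    and hom: "\<And>x. x \<in> E \<Longrightarrow> {j. j < n \<and> hom j x} = A" "real (card A) \<le> p * real n"
    and exc: "\<And>x. x \<in> E \<Longrightarrow> {j. j < n \<and> exc j x} = B"
    and \<beta>: "\<And>x. x \<in> E \<Longrightarrow> \<mu> (cball x (r n)) \<le> ennreal \<beta>"
  shows "\<mu> E \<le> ennreal (real (card (cell 0 ` S)) *
    (K ^ n * (\<epsilon> powr (p * real n) * enn2real (\<mu> UNIV)) + K powr (2 * p * real n) * L ^ n * \<beta>))"
    (is "_ \<le> ennreal (?N * (?U + ?V))")
proof -
  have U: "?U \<ge> 0" and V: "?V \<ge> 0" using K_ge_1 L_ge_1 \<open>\<beta> \<ge> 0\<close> by auto
  have sub0: "cell 0 ` E \<subseteq> cell 0 ` S" using \<open>E \<subseteq> S\<close> by blast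
  have fin0: "finite (cell 0 ` E)" using finite_subset[OF sub0 fin] .
  have N: "real (card (cell 0 ` E)) \<le> ?N" using card_mono[OF fin sub0] by simp
  show ?thesis
  proof (cases "p * real n \<le> real (card B)")
    case True
    have c: "finite (cell n ` E) \<and> real (card (cell n ` E)) \<le> real (card (cell 0 ` E)) * K ^ n"
      using card_image_chain_le[of cell E "\<lambda>_ _. True" "\<lambda>_. K" n, OF fin0] card_children by simp
    have "\<mu> E \<le> ennreal (?N * K ^ n * (\<epsilon> powr (p * real n) * enn2real (\<mu> UNIV)))"
    proof (rule measure_le_cells[of n])
      show "finite (cell n ` E)" using c by simp
      have "real (card (cell 0 ` E)) * K ^ n \<le> ?N * K ^ n"
        using N K_ge_1 by (intro mult_right_mono) auto
      then show "real (card (cell n ` E)) \<le> ?N * K ^ n" using c by linarith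
      show "0 \<le> \<epsilon> powr (p * real n) * enn2real (\<mu> UNIV)" by simp
    next
      fix x assume x: "x \<in> E"
      have "\<mu> {y \<in> E. cell n y = cell n x} \<le> big n x"
        unfolding big_def
      proof (intro outer_mono[OF outer] subsetI)
        fix y assume "y \<in> {y \<in> E. cell n y = cell n x}"
        then show "y \<in> cball (cell n x) (6 * r n)"
          using dist_cell[of y n] r_pos[of n] by (simp add: dist_commute)
      qed
      also have "\<dots> \<le> ennreal (\<epsilon> ^ card B) * \<mu> UNIV" using big_le[of n x] exc[OF x] by simp
      also have "\<dots> = ennreal (\<epsilon> powr real (card B) * enn2real (\<mu> UNIV))"
        using \<epsilon> finite_UNIV by (simp add: powr_realpow ennreal_mult)
      also have "\<dots> \<le> ennreal (\<epsilon> powr (p * real n) * enn2real (\<mu> UNIV))"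
        using True \<epsilon> by (intro ennreal_leI mult_right_mono powr_mono') auto
      finally show "\<mu> {y \<in> E. cell n y = cell n x} \<le> \<dots>" .
    qed
    also have "\<dots> \<le> ennreal (?N * (?U + ?V))"
      using V by (intro ennreal_leI) (simp add: distrib_left mult.assoc)
    finally show ?thesis .
  next
    case False
    have AB: "A \<union> B \<subseteq> {..<n}" if "E \<noteq> {}" using that hom(1) exc by blast
    show ?thesis
    \<comment> \<open>Without a point in \<open>E\<close> nothing forces \<open>A\<close> and
      \<open>B\<close> to consist of scales below \<open>n\<close>.\<close>
    proof (cases "E = {}")
      case True
      then show ?thesis using outer by (simp add: outer_measure_space_def positive_def)
    next
      case ne: False
      \<comment> \<open>At scales in \<open>A \<union> B\<close> nothing is required and a cell has
        at most \<open>K\<close> children; at the others every point of \<open>E\<close> is neither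
        homogeneous nor exceptional, so \<open>L\<close> children suffice.\<close>
      let ?P = "\<lambda>j x. j \<in> A \<union> B \<or> (\<not> hom j x \<and> \<not> exc j x)"
      let ?b = "\<lambda>j. if j \<in> A \<union> B then K else L"
      have E: "{x \<in> E. \<forall>j<n. ?P j x} = E" using hom(1) exc by blast
      have c: "finite (cell n ` E) \<and> real (card (cell n ` E)) \<le> real (card (cell 0 ` E)) * (\<Prod>j<n. ?b j)"
      proof -
        have "finite (cell (Suc j) ` {x. cell j x = Q \<and> ?P j x}) \<and>
          real (card (cell (Suc j) ` {x. cell j x = Q \<and> ?P j x})) \<le> ?b j" for j Q
        proof (cases "j \<in> A \<union> B")
          case True
          then show ?thesis using card_children[of j Q] by simp
        next
          case False
          have "cell (Suc j) ` {x. cell j x = Q \<and> \<not> hom j x \<and> \<not> exc j x} \<subseteq> cell (Suc j) ` {x. cell j x = Q}"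
            by blast
          from finite_subset[OF this card_children(1)] show ?thesis
            using False card_children_good[of j Q] by simp
        qed
        from card_image_chain_le[of cell E ?P ?b n, OF fin0 this] show ?thesis unfolding E .
      qed
      have "card (A \<union> B) \<le> card A + card B" by (rule card_Un_le)
      then have cAB: "real (card (A \<union> B)) \<le> 2 * p * real n" using hom(2) False by linarith
      have fAB: "finite (A \<union> B)" using AB[OF ne] finite_subset by blast
      have "(\<Prod>j<n. ?b j) \<le> (\<Prod>j<n. (if j \<in> A \<union> B then K else 1) * L)"
        using K_ge_1 L_ge_1 by (intro prod_mono) auto
      also have "\<dots> = (\<Prod>j\<in>A \<union> B. K) * L ^ n"
        using AB[OF ne] by (simp only: prod.distrib prod.inter_restrict[symmetric] finite_lessThan Int_absorb1
          prod_constant card_lessThan)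
      also have "(\<Prod>j\<in>A \<union> B. K) = K powr real (card (A \<union> B))"
        using K_ge_1 by (simp add: powr_realpow)
      also have "K powr real (card (A \<union> B)) * L ^ n \<le> K powr (2 * p * real n) * L ^ n"
        using cAB K_ge_1 L_ge_1 by (intro mult_right_mono powr_mono) auto
      finally have b: "(\<Prod>j<n. ?b j) \<le> K powr (2 * p * real n) * L ^ n" .
      have "\<mu> E \<le> ennreal (?N * (K powr (2 * p * real n) * L ^ n) * \<beta>)"
      proof (rule measure_le_cells[of n])
        show "finite (cell n ` E)" using c by simp
        have "real (card (cell 0 ` E)) * (\<Prod>j<n. ?b j) \<le> ?N * (K powr (2 * p * real n) * L ^ n)"
          using N b K_ge_1 L_ge_1 by (intro mult_mono prod_nonneg) auto
        then show "real (card (cell n ` E)) \<le> ?N * (K powr (2 * p * real n) * L ^ n)"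
          using c by linarith
      next
        fix x assume x: "x \<in> E"
        have "{y \<in> E. cell n y = cell n x} \<subseteq> cball x (r n)"
          using dist_same_cell[of n x] by auto
        from outer_mono[OF outer this] \<beta>[OF x]
        show "\<mu> {y \<in> E. cell n y = cell n x} \<le> ennreal \<beta>" by simp
      qed fact
      also have "\<dots> \<le> ennreal (?N * (?U + ?V))"
        using U by (intro ennreal_leI) (simp add: distrib_left mult.assoc)
      finally show ?thesis .
    qed
  qed
qed

text \<open>Sort the points by their pair of homogeneous and exceptional scales below
  \<open>n\<close>; there are \<open>4 ^ n\<close> pairs of subsets.\<close>

lemma measure_few_hom_le:
  assumes fin: "finite (cell 0 ` S)" and "p \<ge> 0" "\<beta> \<ge> 0"
  shows "\<mu> {x \<in> S. real (card {j. j < n \<and> hom j x}) \<le> p * real n \<and> \<mu> (cball x (r n)) \<le> ennreal \<beta>}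
    \<le> ennreal (4 ^ n * (real (card (cell 0 ` S)) *
    (K ^ n * (\<epsilon> powr (p * real n) * enn2real (\<mu> UNIV)) + K powr (2 * p * real n) * L ^ n * \<beta>)))"
    (is "\<mu> ?E \<le> ennreal (4 ^ n * ?M)")
proof -
  let ?I = "Pow {..<n} \<times> Pow {..<n}"
  let ?T = "\<lambda>t. {x \<in> ?E. {j. j < n \<and> hom j x} = fst t \<and> {j. j < n \<and> exc j x} = snd t}"
  have "?E \<subseteq> (\<Union>t\<in>?I. ?T t)"
  proof
    fix x assume "x \<in> ?E"
    then have "x \<in> ?T ({j. j < n \<and> hom j x}, {j. j < n \<and> exc j x})" by simp
    moreover have "({j. j < n \<and> hom j x}, {j. j < n \<and> exc j x}) \<in> ?I" by auto
    ultimately show "x \<in> (\<Union>t\<in>?I. ?T t)" by blast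
  qed
  then have "\<mu> ?E \<le> \<mu> (\<Union>t\<in>?I. ?T t)" by (rule outer_mono[OF outer])
  also have "\<dots> \<le> (\<Sum>t\<in>?I. \<mu> (?T t))" by (intro outer_finite_UN_le[OF outer]) simp
  also have "\<dots> \<le> (\<Sum>t\<in>?I. ennreal ?M)"
  proof (rule sum_mono)
    fix t
    define T where "T = ?T t"
    have T: "T \<subseteq> S" "\<And>x. x \<in> T \<Longrightarrow> {j. j < n \<and> hom j x} = fst t"
      "\<And>x. x \<in> T \<Longrightarrow> {j. j < n \<and> exc j x} = snd t"
      "\<And>x. x \<in> T \<Longrightarrow> \<mu> (cball x (r n)) \<le> ennreal \<beta>"
      "\<And>x. x \<in> T \<Longrightarrow> real (card {j. j < n \<and> hom j x}) \<le> p * real n"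
      unfolding T_def by blast+
    have "\<mu> T \<le> ennreal ?M"
    \<comment> \<open>The bound on the number of homogeneous scales is known at points only; a point
      of \<open>T\<close> transfers it to \<open>fst t\<close>.\<close>
    proof (cases "T = {}")
      case True
      then show ?thesis using outer by (simp add: outer_measure_space_def positive_def)
    next
      case False
      then obtain x where x: "x \<in> T" by blast
      have "real (card (fst t)) \<le> p * real n" using T(5)[OF x] unfolding T(2)[OF x] .
      from measure_type_le[OF fin T(1) assms(2,3) T(2) this T(3,4)] show ?thesis .
    qed
    then show "\<mu> (?T t) \<le> ennreal ?M" unfolding T_def .
  qed
  also have "\<dots> = of_nat (card ?I) * ennreal ?M" by (rule sum_constant)
  also have "card ?I = 4 ^ n"
    by (simp add: card_cartesian_product card_Pow power_mult_distrib[symmetric])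
  also have "of_nat (4 ^ n) * ennreal ?M = ennreal (4 ^ n * ?M)"
    by (subst ennreal_of_nat_eq_real_of_nat, subst ennreal_mult) (use K_ge_1 L_ge_1 assms in auto)
  finally show ?thesis .
qed

end

section \<open>Points with few homogeneous scales\<close>

lemma exists_scale_exponent:
  fixes \<delta> :: real
  assumes "0 < \<delta>" "\<delta> \<le> 1"
  obtains q :: nat where "8 \<le> \<delta> * 2 ^ q" "\<delta> * 2 ^ q \<le> 16"
proof -
  define q where "q = nat \<lceil>log 2 (8 / \<delta>)\<rceil>"
  have "log 2 (8 / \<delta>) \<ge> 0" using assms by simp
  then have q: "log 2 (8 / \<delta>) \<le> real q" "real q \<le> log 2 (8 / \<delta>) + 1"
    unfolding q_def by linarith+
  have "8 / \<delta> = 2 powr log 2 (8 / \<delta>)" using assms by simp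
  also have "\<dots> \<le> 2 powr real q" using q by (intro powr_mono) auto
  finally have 1: "8 / \<delta> \<le> 2 ^ q" by (simp add: powr_realpow)
  have "2 powr real q \<le> 2 powr (log 2 (8 / \<delta>) + 1)" using q by (intro powr_mono) auto
  also have "\<dots> = 16 / \<delta>" using assms by (simp add: powr_add)
  finally have 2: "2 ^ q \<le> 16 / \<delta>" by (simp add: powr_realpow)
  show thesis using that[of q] 1 2 assms by (simp add: field_simps)
qed

text \<open>Writing \<open>k = a + q * j\<close> splits the dyadic scales into \<open>q\<close>
  progressions, each the scale sequence of one tree. The offset \<open>a\<close> starts at 1 because
  \<open>k\<close> does.\<close>

lemma sum_card_residues_le:
  fixes H :: "nat \<Rightarrow> bool"
  shows "(\<Sum>a\<in>{1..q}. card {j. j < n \<and> H (a + q * j)}) \<le> card {k \<in> {1..n * q}. H k}"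
proof -
  let ?A = "SIGMA a:{1..q}. {j. j < n \<and> H (a + q * j)}"
  let ?f = "\<lambda>(a, j). a + q * j"
  have "inj_on ?f ?A"
  proof (rule inj_onI)
    fix u v assume uv: "u \<in> ?A" "v \<in> ?A" "?f u = ?f v"
    obtain a i b j where ab: "u = (a, i)" "v = (b, j)" by (cases u, cases v)
    have r: "1 \<le> a" "a \<le> q" "1 \<le> b" "b \<le> q" and e: "a + q * i = b + q * j" using uv ab by auto
    have lt: "a - 1 < q" "b - 1 < q" using r by linarith+
    \<comment> \<open>Shifted by one, the offsets become residues modulo \<open>q\<close>.\<close>
    have "a - 1 = (a - 1 + q * i) mod q" by (simp only: mod_mult_self2 mod_less[OF lt(1)])
    also have "a - 1 + q * i = b - 1 + q * j" using e r by linarith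
    also have "\<dots> mod q = b - 1" by (simp only: mod_mult_self2 mod_less[OF lt(2)])
    finally have "a = b" using r by linarith
    then show "u = v" using e r ab by simp
  qed
  moreover have "?f ` ?A \<subseteq> {k \<in> {1..n * q}. H k}"
  proof clarsimp
    fix a j assume *: "Suc 0 \<le> a" "a \<le> q" "j < n"
    have "a + q * j \<le> q * Suc j" using * by simp
    also have "\<dots> \<le> q * n" using * by (intro mult_le_mono2) simp
    finally show "a + q * j \<le> n * q" by (simp add: mult.commute)
  qed
  ultimately have "card ?A \<le> card {k \<in> {1..n * q}. H k}"
    by (intro card_inj_on_le) auto
  then show ?thesis by (subst (asm) card_SigmaI) auto
qed

text \<open>By pigeonhole, few homogeneous scales overall means few in one residue class, where the
  tree estimate applies. The factor 4 in \<open>base1\<close> and \<open>base2\<close> pays for the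
  types; \<open>base1\<close> handles many exceptional scales, \<open>base2\<close> the rest, and
  both make the bounds summable.\<close>

lemma few_homogeneous_scales_null:
  fixes \<mu> :: "(real ^ 'n) set \<Rightarrow> ennreal"
  assumes outer: "outer_measure_space UNIV \<mu>" and finite_UNIV: "\<mu> UNIV < \<infinity>"
    and S: "bounded S" and \<delta>: "0 < \<delta>" "\<delta> \<le> 1" and \<epsilon>: "0 < \<epsilon>" "\<epsilon> \<le> 1" and m: "m \<ge> 0"
    and q: "8 \<le> \<delta> * 2 ^ q" "\<delta> * 2 ^ q \<le> 16" and p: "p \<ge> 0"
    and base1: "4 * child_bound CARD('n) q * \<epsilon> powr p \<le> 1 / 2"
    and base2: "4 * child_bound CARD('n) q powr (2 * p) * good_child_bound CARD('n) m \<delta>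
      * 2 powr (- t * real q) \<le> 1 / 2"
  shows "\<mu> {x. \<exists>\<^sub>F n in sequentially. x \<in> S \<and>
      real (card {k \<in> {1..n * q}. local_hom \<delta> \<epsilon> (2 powr - real k) \<mu> x \<ge> ennreal (\<delta> powr - m)})
        \<le> p * real (n * q) \<and>
      \<mu> (cball x (2 powr - real (n * q))) \<le> ennreal (2 powr (- t * real (n * q)))} = 0"
proof -
  let ?H = "\<lambda>x k. local_hom \<delta> \<epsilon> (2 powr - real k) \<mu> x \<ge> ennreal (\<delta> powr - m)"
  let ?b = "\<lambda>n. 2 powr (- t * real (n * q))"
  let ?E = "\<lambda>n. {x \<in> S. real (card {k \<in> {1..n * q}. ?H x k}) \<le> p * real (n * q) \<and>
    \<mu> (cball x (2 powr - real (n * q))) \<le> ennreal (?b n)}"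
  let ?K = "child_bound CARD('n) q"
  let ?L = "good_child_bound CARD('n) m \<delta>"
  let ?M = "enn2real (\<mu> UNIV)"
  have tree: "scale_tree \<mu> \<delta> \<epsilon> m (2 powr - real a) q ?K ?L" for a :: nat
    using assms by unfold_locales auto
  have qpos: "q > 0" using q \<delta> by (cases q) auto
  define N where "N a = card (scale_tree.cell (2 powr - real a) q 0 ` S)" for a :: nat
  define F where "F a n = {x \<in> S. real (card {j. j < n \<and> ?H x (a + q * j)}) \<le> p * real n \<and>
    \<mu> (cball x (2 powr - real (a + q * n))) \<le> ennreal (?b n)}" for a n
  have F: "\<mu> (F a n) \<le> ennreal (real (N a) * (?M + 1) / 2 ^ n)" for a n
  proof -
    interpret scale_tree \<mu> \<delta> \<epsilon> m "2 powr - real a" q ?K ?L by (rule tree)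
    have r: "r j = 2 powr - real (a + q * j)" for j
    proof -
      have "r j = 2 powr - real a / 2 powr real (q * j)"
        unfolding r_def by (subst powr_realpow) simp_all
      also have "\<dots> = 2 powr (- real a - real (q * j))" by (simp only: powr_diff)
      also have "- real a - real (q * j) = - real (a + q * j)" by simp
      finally show ?thesis .
    qed
    have "finite (cell 0 ` S)"
    proof -
      let ?\<rho> = "r 0 / (2 * real CARD('n))"
      have \<rho>: "?\<rho> > 0" using r_pos by simp
      obtain R where R: "R > 0" "S \<subseteq> cball 0 R" using bounded_subset_ballD[OF S] ball_subset_cball by blast
      have "finite (grid_round ?\<rho> ` cball 0 (R / ?\<rho> * ?\<rho>) :: (real ^ 'n) set)"
        using R \<rho> by (intro card_grid_round_cball divide_nonneg_pos) simp_all
      moreover have "R / ?\<rho> * ?\<rho> = R" using r_pos[of 0] by simp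
      ultimately have "finite (cell 0 ` cball 0 R)" unfolding cell_def by simp
      then show ?thesis using R finite_subset image_mono by metis
    qed
    from measure_few_hom_le[OF this p, of "?b n" n]
    have "\<mu> (F a n) \<le> ennreal (4 ^ n * (real (N a) *
      (?K ^ n * (\<epsilon> powr (p * real n) * ?M) + ?K powr (2 * p * real n) * ?L ^ n * ?b n)))"
      by (simp add: F_def N_def hom_def r)
    \<comment> \<open>Both summands become \<open>n\<close>-th powers of the quantities in
      \<open>base1\<close> and \<open>base2\<close>.\<close>
    also have "4 ^ n * (real (N a) *
      (?K ^ n * (\<epsilon> powr (p * real n) * ?M) + ?K powr (2 * p * real n) * ?L ^ n * ?b n)) =
      real (N a) * ((4 * ?K * \<epsilon> powr p) ^ n * ?M + (4 * ?K powr (2 * p) * ?L * 2 powr (- t * real q)) ^ n)"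
    proof -
      have pw: "(x powr y) ^ n = x powr (y * real n)" if "x > 0" for x y :: real
        using that by (simp add: powr_realpow[symmetric] powr_powr)
      have "?b n = (2 powr (- t * real q)) ^ n" by (simp add: pw mult_ac)
      moreover have "\<epsilon> powr (p * real n) = (\<epsilon> powr p) ^ n" using \<epsilon> by (simp add: pw)
      moreover have "?K powr (2 * p * real n) = (?K powr (2 * p)) ^ n"
        using K_ge_1 by (simp add: pw)
      ultimately show ?thesis by (simp only: power_mult_distrib) (simp add: algebra_simps)
    qed
    also have "\<dots> \<le> real (N a) * ((1 / 2) ^ n * ?M + (1 / 2) ^ n)"
      using base1 base2 K_ge_1 L_ge_1
      by (intro mult_left_mono add_mono mult_right_mono power_mono) auto
    also have "\<dots> = real (N a) * (?M + 1) / 2 ^ n" by (simp add: field_simps power_one_over)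
    finally show ?thesis by (simp add: ennreal_leI)
  qed
  have EF: "?E n \<subseteq> (\<Union>a\<in>{1..q}. F a n)" for n
  proof
    fix x assume x: "x \<in> ?E n"
    have "\<exists>a\<in>{1..q}. real (card {j. j < n \<and> ?H x (a + q * j)}) \<le> p * real n"
    proof (rule ccontr)
      assume "\<not> ?thesis"
      then have "(\<Sum>a\<in>{1..q}. p * real n) < (\<Sum>a\<in>{1..q}. real (card {j. j < n \<and> ?H x (a + q * j)}))"
        using qpos by (intro sum_strict_mono) (auto simp: not_le)
      also have "\<dots> \<le> real (card {k \<in> {1..n * q}. ?H x k})"
        using sum_card_residues_le[of n "?H x" q] by (simp only: of_nat_le_iff flip: of_nat_sum)
      also have "\<dots> \<le> p * real (n * q)" using x by blast
      finally show False by (simp add: mult_ac)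
    qed
    then obtain a where a: "a \<in> {1..q}" "real (card {j. j < n \<and> ?H x (a + q * j)}) \<le> p * real n" by blast
    \<comment> \<open>The tree with offset \<open>a\<close> uses a smaller ball, which inherits the
      upper bound on the measure.\<close>
    have "cball x (2 powr - real (a + q * n)) \<subseteq> cball x (2 powr - real (n * q))"
      by (intro subset_cball powr_mono) (auto simp: mult.commute)
    from order_trans[OF outer_mono[OF outer this]] x a(2)
    have "x \<in> F a n" unfolding F_def by blast
    then show "x \<in> (\<Union>a\<in>{1..q}. F a n)" using a(1) by blast
  qed
  have "\<mu> (?E n) \<le> ennreal ((\<Sum>a\<in>{1..q}. real (N a)) * (?M + 1) / 2 ^ n)" for n
  proof -
    have "\<mu> (?E n) \<le> \<mu> (\<Union>a\<in>{1..q}. F a n)" by (rule outer_mono[OF outer EF])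
    also have "\<dots> \<le> (\<Sum>a\<in>{1..q}. \<mu> (F a n))" by (rule outer_finite_UN_le[OF outer]) simp
    also have "\<dots> \<le> (\<Sum>a\<in>{1..q}. ennreal (real (N a) * (?M + 1) / 2 ^ n))" by (intro sum_mono F)
    also have "\<dots> = ennreal (\<Sum>a\<in>{1..q}. real (N a) * (?M + 1) / 2 ^ n)"
      by (intro sum_ennreal) auto
    also have "(\<Sum>a\<in>{1..q}. real (N a) * (?M + 1) / 2 ^ n) = (\<Sum>a\<in>{1..q}. real (N a)) * (?M + 1) / 2 ^ n"
      by (simp only: sum_distrib_right sum_divide_distrib)
    finally show ?thesis .
  qed
  then have "\<mu> {x. \<exists>\<^sub>F n in sequentially. x \<in> ?E n} = 0"
    by (intro outer_borel_cantelli[OF outer, of 0]) (auto intro!: sum_nonneg mult_nonneg_nonneg)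
  then show ?thesis by simp
qed

section \<open>Local dimensions\<close>

text \<open>The positive lower bound and finiteness exclude both infinite values of
  \<open>elog\<close>.\<close>

lemma elog_ge:
  assumes "ennreal (exp c) \<le> a" "a < \<infinity>"
  obtains v where "elog a = ereal v" "c \<le> v"
proof -
  have a: "a = ennreal (enn2real a)" using assms by simp
  then have e: "exp c \<le> enn2real a"
    using assms(1) by (metis enn2real_nonneg ennreal_le_iff)
  then have "0 < enn2real a" using exp_gt_zero[of c] by linarith
  then have "elog a = ereal (ln (enn2real a))" "c \<le> ln (enn2real a)"
    using assms(2) e by (auto simp: elog_def ln_ge_iff enn2real_positive_iff)
  then show thesis by (rule that)
qed

text \<open>Since \<open>ln r\<close> is negative, a lower bound on the ball measure bounds the
  quotient above by \<open>t\<close>; infinitely many radii tending to 0 suffice for the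
  liminf.\<close>

lemma lower_local_dim_less:
  assumes fin: "\<And>A. \<mu> A < \<infinity>" and q: "q > 0" and "t < s"
    and freq: "\<exists>\<^sub>F n in sequentially. \<mu> (cball x (2 powr - real (n * q))) \<ge> ennreal (2 powr (- t * real (n * q)))"
  shows "lower_local_dim \<mu> x < ereal s"
proof (rule ccontr)
  assume "\<not> ?thesis"
  then have "ereal t < lower_local_dim \<mu> x"
    using \<open>t < s\<close> by (metis ereal_less(2) less_le_trans linorder_not_less ereal_less_eq(3) less_ereal.simps(1))
  then have ev: "\<forall>\<^sub>F r in at_right 0. ereal t < elog (\<mu> (cball x r)) / ereal (ln r)"
    unfolding lower_local_dim_def by (rule less_LiminfD)
  have "(\<lambda>n. 2 powr - real (n * q)) \<longlonglongrightarrow> (0::real)"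
  proof -
    have "(\<lambda>n. (1 / 2 ^ q) ^ n) \<longlonglongrightarrow> (0::real)"
      using q one_less_power[of "2::real" q] by (intro LIMSEQ_realpow_zero) auto
    moreover have "(1 / 2 ^ q) ^ n = (2::real) powr - real (n * q)" for n
      by (simp add: powr_minus powr_realpow power_one_over mult.commute flip: power_mult of_nat_mult)
         (simp add: field_simps)
    ultimately show ?thesis by simp
  qed
  then have "filterlim (\<lambda>n. 2 powr - real (n * q)) (at_right (0::real)) sequentially"
    by (rule tendsto_imp_filterlim_at_right) simp
  from filterlim_iff[THEN iffD1, OF this, rule_format, OF ev]
  have "\<forall>\<^sub>F n in sequentially. ereal t < elog (\<mu> (cball x (2 powr - real (n * q)))) / ereal (ln (2 powr - real (n * q)))" .
  \<comment> \<open>The condition \<open>n > 0\<close> makes the radius less than 1, so its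
    logarithm is negative and not 0.\<close>
  from frequently_eventually_conj[OF freq eventually_conj[OF this eventually_gt_at_top[of 0]]]
  obtain n where n: "\<mu> (cball x (2 powr - real (n * q))) \<ge> ennreal (2 powr (- t * real (n * q)))"
    "ereal t < elog (\<mu> (cball x (2 powr - real (n * q)))) / ereal (ln (2 powr - real (n * q)))" "n > 0"
    by (auto dest: frequently_ex)
  have "2 powr (- t * real (n * q)) = exp (- t * (real (n * q) * ln 2))" by (simp add: powr_def)
  then obtain v where v: "elog (\<mu> (cball x (2 powr - real (n * q)))) = ereal v" "- t * (real (n * q) * ln 2) \<le> v"
    using elog_ge n(1) fin by metis
  let ?w = "real (n * q) * ln 2"
  have w: "?w > 0" using n(3) q by simp
  have "ln (2 powr - real (n * q)) = - ?w" by (simp add: ln_powr)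
  then have "ereal t < ereal v / ereal (- ?w)" using n(2) v(1) by (simp only:)
  then have "t < v / - ?w" using w by (simp only: ereal_divide less_ereal.simps split: if_splits)
  then have "v < - t * ?w" using w by (simp add: neg_less_divide_eq field_simps del: of_nat_mult)
  then show False using v(2) by simp
qed

text \<open>Every small radius is compared with the sequence member just below it. The logarithms
  differ by at most the constant \<open>c\<close>, which passing from \<open>t\<close> to
  \<open>t'\<close> absorbs.\<close>

lemma upper_local_dim_less:
  assumes outer: "outer_measure_space UNIV \<mu>" and fin: "\<And>A. \<mu> A < \<infinity>"
    and q: "q > 0" and t: "0 < t" "t < s"
    and ev: "\<forall>\<^sub>F n in sequentially. \<mu> (cball x (2 powr - real (n * q))) \<ge> ennreal (2 powr (- t * real (n * q)))"
  shows "upper_local_dim \<mu> x < ereal s"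
proof -
  define t' where "t' = (t + s) / 2"
  have t': "t < t'" "t' < s" using t by (auto simp: t'_def)
  obtain n1 where n1: "\<And>n. n \<ge> n1 \<Longrightarrow> \<mu> (cball x (2 powr - real (n * q))) \<ge> ennreal (2 powr (- t * real (n * q)))"
    using ev by (auto simp: eventually_sequentially)
  define c where "c = real q * ln 2"
  have c: "c > 0" using q by (simp add: c_def)
  \<comment> \<open>With \<open>u = - ln r\<close> the three terms ensure \<open>u > 0\<close>, an
    index \<open>k\<close> beyond \<open>n1\<close>, and
    \<open>t * (u + c) \<le> t' * u\<close>.\<close>
  define U where "U = max (max 1 (real n1 * c)) (t * c / (t' - t))"
  have bound: "elog (\<mu> (cball x r)) / ereal (ln r) \<le> ereal t'" if r: "0 < r" "r < exp (- U)" for r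
  proof -
    define u where "u = - ln r"
    have u: "u > U" using r ln_less_cancel_iff[of r "exp (- U)"] by (simp add: u_def)
    then have u1: "u > 0" "u \<ge> real n1 * c" "u \<ge> t * c / (t' - t)" by (auto simp: U_def)
    define k where "k = nat (\<lfloor>u / c\<rfloor> + 1)"
    have "u / c > 0" using u1 c by simp
    then have k: "u / c \<le> real k" "real k \<le> u / c + 1" unfolding k_def by linarith+
    have "real n1 \<le> u / c" using u1 c by (simp add: pos_le_divide_eq)
    then have kn: "k \<ge> n1" using k by linarith
    have kc: "u \<le> real k * c" "real k * c \<le> u + c"
      using k c mult_right_mono[OF k(2), of c] by (auto simp: pos_divide_le_eq distrib_right)
    have e: "2 powr (y * real (k * q)) = exp (y * (real k * c))" for y :: real
      by (simp add: powr_def c_def)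
    have "2 powr - real (k * q) = exp (- (real k * c))" using e[of "-1"] by simp
    also have "\<dots> \<le> exp (ln r)" using kc(1) by (simp add: u_def)
    finally have "cball x (2 powr - real (k * q)) \<subseteq> cball x r" using r by (intro subset_cball) simp
    then have "ennreal (exp (- t * (real k * c))) \<le> \<mu> (cball x r)"
      using order_trans[OF n1[OF kn] outer_mono[OF outer]] unfolding e by blast
    then obtain v where v: "elog (\<mu> (cball x r)) = ereal v" "- t * (real k * c) \<le> v"
      using fin elog_ge by blast
    have "- v \<le> t * (real k * c)" using v by simp
    also have "\<dots> \<le> t * (u + c)" using kc t by (intro mult_left_mono) auto
    also have "\<dots> \<le> t' * u" using u1(3) t' by (simp add: pos_divide_le_eq algebra_simps)
    finally have "- v / u \<le> t'" using pos_divide_le_eq[OF u1(1), of "- v" t'] by (simp only:)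
    moreover have "v / ln r = - v / u" by (simp add: u_def)
    moreover have "ln r \<noteq> 0" using u1 by (simp add: u_def)
    ultimately show ?thesis using v by simp
  qed
  have "\<forall>\<^sub>F r in at_right 0. elog (\<mu> (cball x r)) / ereal (ln r) \<le> ereal t'"
    unfolding eventually_at_right_field using bound exp_gt_zero by blast
  then have "upper_local_dim \<mu> x \<le> ereal t'"
    unfolding upper_local_dim_def by (rule Limsup_bounded)
  then show ?thesis using t' by (metis le_less_trans less_ereal.simps(1))
qed

section \<open>Choice of the constants\<close>

text \<open>By the choice of \<open>p\<close> the first power contributes
  \<open>2 powr (q * (t - m) / 2)\<close>, the good children at most \<open>2 powr (q * m)\<close>,
  and \<open>D\<close> collects the factors depending on the dimension and \<open>p\<close>. The
  exponent left over is \<open>- q * (t - m) / 2\<close>, and \<open>2 ^ q\<close> is large enough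
  for it to beat \<open>2 * D\<close>.\<close>

lemma child_bounds_small:
  fixes m t \<delta> :: real
  assumes m: "0 < m" "m < t" and d: "d > 0" and \<delta>: "0 < \<delta>" "8 \<le> \<delta> * 2 ^ q"
    and p: "p = (t - m) / (4 * real d)"
    and D: "D = 4 * ((4 * real d) ^ d) powr (2 * p) * (2 * (64 * real d) + 2) ^ d"
    and q: "(2 * D) powr (2 / (t - m)) \<le> 2 ^ q"
  shows "4 * child_bound d q powr (2 * p) * good_child_bound d m \<delta> * 2 powr (- t * real q) \<le> 1 / 2"
proof -
  have p0: "p > 0" using m d by (simp add: p)
  have D0: "D > 0" using d by (simp add: D add_pos_nonneg)
  have pdm: "real q * real d * (2 * p) = real q * ((t - m) / 2)" using d by (simp add: p)
  have "child_bound d q \<le> (4 * real d * 2 ^ q) ^ d"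
    unfolding child_bound_def
  proof (intro power_mono)
    have "1 * 1 \<le> (2::real) ^ q * real d" using d by (intro mult_mono) auto
    then show "2 * (2 ^ q * real d) + 2 \<le> 4 * real d * 2 ^ q" by (simp add: mult_ac)
  qed simp
  then have "child_bound d q powr (2 * p) \<le> ((4 * real d * 2 ^ q) ^ d) powr (2 * p)"
    using p0 child_bound_ge_1[of d q] by (intro powr_mono2) auto
  also have "\<dots> = ((4 * real d) ^ d) powr (2 * p) * (2 powr (real q * real d)) powr (2 * p)"
    using d by (simp add: power_mult_distrib powr_mult powr_realpow flip: power_mult of_nat_mult)
  also have "\<dots> = ((4 * real d) ^ d) powr (2 * p) * 2 powr (real q * ((t - m) / 2))"
    unfolding powr_powr pdm ..
  finally have 1: "child_bound d q powr (2 * p) \<le> \<dots>" .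
  have "2 powr - real q \<le> \<delta>" using \<delta> by (simp add: powr_minus powr_realpow field_simps)
  then have "\<delta> powr - m \<le> (2 powr - real q) powr - m" using m by (intro powr_mono2') auto
  then have 2: "good_child_bound d m \<delta> \<le> (2 * (64 * real d) + 2) ^ d * 2 powr (real q * m)"
    unfolding good_child_bound_def powr_powr by (intro mult_left_mono) auto
  have "(2 ^ q) powr - ((t - m) / 2) \<le> ((2 * D) powr (2 / (t - m))) powr - ((t - m) / 2)"
    using q m D0 by (intro powr_mono2') auto
  also have "\<dots> = (2 * D) powr - 1"
    unfolding powr_powr by (rule arg_cong[where f = "(powr) (2 * D)"]) (use m in simp)
  also have "\<dots> = 1 / (2 * D)" using D0 by (simp add: powr_minus_divide)
  finally have 3: "2 powr - (real q * ((t - m) / 2)) \<le> 1 / (2 * D)"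
    by (simp add: powr_powr flip: powr_realpow)
  have "4 * child_bound d q powr (2 * p) * good_child_bound d m \<delta> * 2 powr (- t * real q) \<le>
    4 * (((4 * real d) ^ d) powr (2 * p) * 2 powr (real q * ((t - m) / 2))) *
    ((2 * (64 * real d) + 2) ^ d * 2 powr (real q * m)) * 2 powr (- t * real q)"
    using 1 2 by (intro mult_mono mult_nonneg_nonneg) (auto simp: good_child_bound_def)
  also have "\<dots> = D * (2 powr (real q * ((t - m) / 2)) * 2 powr (real q * m) * 2 powr (- t * real q))"
    by (simp add: D)
  also have "2 powr (real q * ((t - m) / 2)) * 2 powr (real q * m) * 2 powr (- t * real q) =
      2 powr - (real q * ((t - m) / 2))"
    unfolding powr_add[symmetric] by (rule arg_cong[where f = "(powr) 2"]) (simp add: field_simps)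
  also have "D * \<dots> \<le> D * (1 / (2 * D))" using 3 D0 by (intro mult_left_mono) auto
  finally show ?thesis using D0 by simp
qed

text \<open>Rounding \<open>N\<close> down to a multiple of \<open>q\<close> loses less than
  \<open>q\<close>, hence at most half of \<open>N\<close> when \<open>q \<le> N\<close>. This costs
  the factor 2.\<close>

lemma few_scales_at_multiple:
  assumes few: "\<not> many_homogeneous_scales m p \<delta> \<epsilon> \<mu> x N" and "p \<ge> 0" "q \<le> N" "q > 0"
  shows "real (card {k \<in> {1..N div q * q}. local_hom \<delta> \<epsilon> (2 powr - real k) \<mu> x \<ge> ennreal (\<delta> powr - m)})
    \<le> 2 * p * real (N div q * q)"
proof -
  let ?n = "N div q * q"
  let ?P = "\<lambda>k. local_hom \<delta> \<epsilon> (2 powr - real k) \<mu> x \<ge> ennreal (\<delta> powr - m)"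
  have "card {k \<in> {1..?n}. ?P k} \<le> card {k \<in> {1..N}. ?P k}"
    by (intro card_mono) (auto intro: order_trans div_times_less_eq_dividend)
  then have "real (card {k \<in> {1..?n}. ?P k}) \<le> p * real N"
    using few unfolding many_homogeneous_scales_def by linarith
  also have "N \<le> 2 * ?n"
  proof -
    have "N = ?n + N mod q" by simp
    moreover have "N mod q < q" using assms by simp
    moreover have "1 * q \<le> ?n" using assms by (intro mult_right_mono) (auto simp: div_greater_zero_iff Suc_leI)
    ultimately show ?thesis by linarith
  qed
  then have "p * real N \<le> p * real (2 * ?n)" using assms by (intro mult_left_mono of_nat_mono)
  finally show ?thesis by simp
qed

theorem theorem1p1:
  fixes m s :: real
  assumes "0 < m" and "m < s" and "s < real CARD('n::finite)"
  shows "\<exists>p>0. \<exists>\<delta>\<^sub>0>0. \<forall>\<delta>. 0 < \<delta> \<and> \<delta> < \<delta>\<^sub>0 \<longrightarrow>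
    (\<exists>\<epsilon>>0. \<forall>\<mu> :: (real ^ 'n) set \<Rightarrow> ennreal. compactly_supported_measure \<mu> \<longrightarrow>
       almost_all_in \<mu> (Omega_lower s \<mu>)
         (\<lambda>x. \<forall>\<^sub>F N in sequentially. many_homogeneous_scales m p \<delta> \<epsilon> \<mu> x N) \<and>
       almost_all_in \<mu> (Omega_upper s \<mu>)
         (\<lambda>x. \<exists>\<^sub>F N in sequentially. many_homogeneous_scales m p \<delta> \<epsilon> \<mu> x N))"
proof -
  \<comment> \<open>The gap above \<open>m\<close> makes the cell count summable; the gap below
    \<open>s\<close> gives the strict bounds on the dimensions.\<close>
  define t where "t = (m + s) / 2"
  have t: "m < t" "t < s" "0 < t" using assms by (auto simp: t_def)
  define p where "p = (t - m) / (4 * real CARD('n))"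
  have p: "p > 0" using t by (simp add: p_def)
  define D where "D = 4 * ((4 * real CARD('n)) ^ CARD('n)) powr (2 * p) * (2 * (64 * real CARD('n)) + 2) ^ CARD('n)"
  define Z where "Z = (2 * D) powr (2 / (t - m))"
  have "D > 0" by (simp add: D_def add_pos_nonneg)
  then have Z: "Z > 0" by (simp add: Z_def)
  \<comment> \<open>Since \<open>2 ^ q \<ge> 8 / \<delta>\<close>, the bound \<open>8 / Z\<close>
    forces \<open>2 ^ q > Z\<close>, as \<open>child_bounds_small\<close> demands.\<close>
  define \<delta>\<^sub>0 where "\<delta>\<^sub>0 = min 1 (8 / Z)"
  have "\<delta>\<^sub>0 > 0" using Z by (simp add: \<delta>\<^sub>0_def)
  moreover have "\<exists>\<epsilon>>0. \<forall>\<mu> :: (real ^ 'n) set \<Rightarrow> ennreal. compactly_supported_measure \<mu> \<longrightarrow>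
       almost_all_in \<mu> (Omega_lower s \<mu>)
         (\<lambda>x. \<forall>\<^sub>F N in sequentially. many_homogeneous_scales m (p / 2) \<delta> \<epsilon> \<mu> x N) \<and>
       almost_all_in \<mu> (Omega_upper s \<mu>)
         (\<lambda>x. \<exists>\<^sub>F N in sequentially. many_homogeneous_scales m (p / 2) \<delta> \<epsilon> \<mu> x N)"
    if "0 < \<delta>" "\<delta> < \<delta>\<^sub>0" for \<delta>
  proof -
    have \<delta>: "0 < \<delta>" "\<delta> \<le> 1" "\<delta> < 8 / Z" using that by (auto simp: \<delta>\<^sub>0_def)
    obtain q where q: "8 \<le> \<delta> * 2 ^ q" "\<delta> * 2 ^ q \<le> 16" by (rule exists_scale_exponent[OF \<delta>(1,2)])
    have qpos: "q > 0" using q \<delta> by (cases q) auto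
    have "Z < 8 / \<delta>" using \<delta> Z by (simp add: field_simps)
    also have "\<dots> \<le> 2 ^ q" using q \<delta> by (simp add: field_simps)
    finally have base2: "4 * child_bound CARD('n) q powr (2 * p) * good_child_bound CARD('n) m \<delta>
      * 2 powr (- t * real q) \<le> 1 / 2"
      using child_bounds_small[OF assms(1) t(1) _ \<delta>(1) q(1) p_def D_def] by (simp add: Z_def)
    define K where "K = child_bound CARD('n) q"
    have K: "K \<ge> 1" unfolding K_def by (rule child_bound_ge_1)
    \<comment> \<open>Solves \<open>4 * K * \<epsilon> powr p = 1 / 2\<close>. As \<open>K\<close>
      depends on \<open>\<delta>\<close> through \<open>q\<close>, so does
      \<open>\<epsilon>\<close>, but it is fixed before the measure.\<close>
    define \<epsilon> where "\<epsilon> = (1 / (8 * K)) powr (1 / p)"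
    have \<epsilon>: "0 < \<epsilon>" "\<epsilon> \<le> 1" using K p unfolding \<epsilon>_def by (auto intro!: powr_le1)
    have "\<epsilon> powr p = 1 / (8 * K)" using K p by (simp add: \<epsilon>_def powr_powr)
    then have base1: "4 * child_bound CARD('n) q * \<epsilon> powr p \<le> 1 / 2"
      using K by (simp flip: K_def)
    have "almost_all_in \<mu> (Omega_lower s \<mu>)
         (\<lambda>x. \<forall>\<^sub>F N in sequentially. many_homogeneous_scales m (p / 2) \<delta> \<epsilon> \<mu> x N) \<and>
       almost_all_in \<mu> (Omega_upper s \<mu>)
         (\<lambda>x. \<exists>\<^sub>F N in sequentially. many_homogeneous_scales m (p / 2) \<delta> \<epsilon> \<mu> x N)"
      if \<mu>: "compactly_supported_measure \<mu>" for \<mu> :: "(real ^ 'n) set \<Rightarrow> ennreal"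
    proof -
      have outer: "outer_measure_space UNIV \<mu>" and cpt: "compact (outer_support \<mu>)"
        using \<mu> by (auto simp: compactly_supported_measure_def)
      have fin: "\<mu> A < \<infinity>" for A
        using compactly_supported_measure_finite[OF \<mu>] outer_mono[OF outer, of A UNIV]
        by (auto intro: le_less_trans)
      let ?many = "many_homogeneous_scales m (p / 2) \<delta> \<epsilon> \<mu>"
      let ?few = "\<lambda>x n. real (card {k \<in> {1..n * q}. local_hom \<delta> \<epsilon> (2 powr - real k) \<mu> x
        \<ge> ennreal (\<delta> powr - m)}) \<le> p * real (n * q)"
      let ?b = "\<lambda>n. ennreal (2 powr (- t * real (n * q)))"
      \<comment> \<open>The support is bounded, so it meets only finitely many cells of the first
        scale; its complement is null.\<close>
      define Bad where "Bad = {x. \<exists>\<^sub>F n in sequentially. x \<in> outer_support \<mu> \<and> ?few x n \<and>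
        \<mu> (cball x (2 powr - real (n * q))) \<le> ?b n}"
      have "\<mu> Bad = 0"
        unfolding Bad_def
        by (rule few_homogeneous_scales_null[OF outer fin compact_imp_bounded[OF cpt] \<delta>(1,2) \<epsilon> _ q _
              base1 base2]) (use assms p in auto)
      then have null: "\<mu> (\<Union>{Bad, - outer_support \<mu>}) = 0"
        using outer_support_null[OF outer] by (intro outer_null_Union[OF outer]) auto
      have few: "?few x (N div q)" if "\<not> ?many x N" "q \<le> N" for x N
        using few_scales_at_multiple[OF that(1) _ that(2) qpos] p by simp
      \<comment> \<open>Off the null set, few homogeneous scales force a lower bound on the ball
        measure at all large \<open>n\<close>.\<close>
      have ev: "\<forall>\<^sub>F n in sequentially. ?few x n \<longrightarrow> ?b n \<le> \<mu> (cball x (2 powr - real (n * q)))"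
        if "x \<notin> \<Union>{Bad, - outer_support \<mu>}" for x
      proof -
        have "\<forall>\<^sub>F n in sequentially. \<not> (x \<in> outer_support \<mu> \<and> ?few x n \<and>
          \<mu> (cball x (2 powr - real (n * q))) \<le> ?b n)"
          using that by (simp add: Bad_def not_frequently)
        then show ?thesis by (rule eventually_mono) (use that in auto)
      qed
      \<comment> \<open>Failure for infinitely many \<open>N\<close> gives the lower bound at
        infinitely many radii, which contradicts the liminf.\<close>
      have "{x \<in> Omega_lower s \<mu>. \<not> (\<forall>\<^sub>F N in sequentially. ?many x N)} \<subseteq> \<Union>{Bad, - outer_support \<mu>}"
      proof (rule subsetI, rule ccontr)
        fix x assume x: "x \<in> {x \<in> Omega_lower s \<mu>. \<not> (\<forall>\<^sub>F N in sequentially. ?many x N)}"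
          and nx: "x \<notin> \<Union>{Bad, - outer_support \<mu>}"
        have "\<exists>\<^sub>F n in sequentially. ?few x n"
          unfolding frequently_sequentially
        proof
          fix n1
          have "\<exists>\<^sub>F N in sequentially. \<not> ?many x N" using x by (simp add: not_eventually)
          then obtain N where N: "N \<ge> (n1 + 1) * q" "\<not> ?many x N" unfolding frequently_sequentially by blast
          have "n1 + 1 \<le> N div q" using N(1) qpos by (simp only: less_eq_div_iff_mult_less_eq)
          moreover have "q \<le> N" using N(1) by simp
          ultimately show "\<exists>n\<ge>n1. ?few x n" using few[OF N(2)] by (intro exI[of _ "N div q"]) linarith
        qed
        from frequently_rev_mp[OF this ev[OF nx]]
        have "lower_local_dim \<mu> x < ereal s" by (rule lower_local_dim_less[OF fin qpos t(2)])
        then show False using x by (auto simp: Omega_lower_def dest: leD)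
      qed
      \<comment> \<open>Failure for all large \<open>N\<close> gives it at all large
        \<open>n\<close>, which contradicts the limsup.\<close>
      moreover have "{x \<in> Omega_upper s \<mu>. \<not> (\<exists>\<^sub>F N in sequentially. ?many x N)} \<subseteq> \<Union>{Bad, - outer_support \<mu>}"
      proof (rule subsetI, rule ccontr)
        fix x assume x: "x \<in> {x \<in> Omega_upper s \<mu>. \<not> (\<exists>\<^sub>F N in sequentially. ?many x N)}"
          and nx: "x \<notin> \<Union>{Bad, - outer_support \<mu>}"
        then obtain N1 where N1: "\<And>N. N \<ge> N1 \<Longrightarrow> \<not> ?many x N"
          by (auto simp: not_frequently eventually_sequentially)
        have "\<forall>\<^sub>F n in sequentially. ?few x n"
          unfolding eventually_sequentially
        \<comment> \<open>Adding 1 makes \<open>n\<close> positive, so that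
          \<open>q \<le> n * q\<close>.\<close>
        proof (intro exI[of _ "N1 + 1"] allI impI)
          fix n assume n: "N1 + 1 \<le> n"
          have "n * 1 \<le> n * q" "1 * q \<le> n * q" using n qpos by (intro mult_le_mono; simp)+
          then have "\<not> ?many x (n * q)" "q \<le> n * q" using N1[of "n * q"] n by linarith+
          from few[OF this] show "?few x n" using qpos by simp
        qed
        from eventually_rev_mp[OF this ev[OF nx]]
        have "upper_local_dim \<mu> x < ereal s" by (rule upper_local_dim_less[OF outer fin qpos t(3,2)])
        then show False using x by (auto simp: Omega_upper_def dest: leD)
      qed
      moreover have "\<mu> A = 0" if "A \<subseteq> \<Union>{Bad, - outer_support \<mu>}" for A
        using outer_mono[OF outer that] unfolding null by simp
      ultimately show ?thesis unfolding almost_all_in_def by blast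
    qed
    then show ?thesis using \<epsilon> by blast
  qed
  ultimately show ?thesis using p by (intro exI[of _ "p / 2"]) auto
qed

end
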